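(* Let $X$ be a Banach space, $A\subset X$ and $f$ a function with $\operatorname{Dom}(f)\subset X$. Let $\phi(X,A,f,C_1,\ldots,C_k)$ be a statement concerning the Banach space $X$, the set $A$, the function $f$ and constants $C_1,\ldots,C_k$. Consider the following conditions: (i) $\phi(X,A,f,C_1,\ldots,C_k)$ is separably determined by the method of suitable models. (ii) $\phi(X,A,f,C_1,\ldots,C_k)$ is separably determined by the method of rich families. Then (ii) implies (i). Moreover, if $X$ has a fundamental minimal system $\{x_i\}_{i\in I}$ or $\operatorname{dens} X=\aleph_1$, then both conditions are equivalent.
   Context: Banach spaces are over the real numbers. "Countable" means finite or countably infinite. $\operatorname{Dom}(f)$ denotes the domain of $f$, and $f\upharpoonright_Z$ denotes the restriction of $f$ to $Z$ (i.e. to $Z\cap\operatorname{Dom}(f)$). $\operatorname{dens}X$ is the density of $X$ (least cardinality of a dense subset). Rich families. A family $\mathcal F$ of separable subspaces of a Banach space $X$ is called rich if (1) each separable subspace of $X$ is contained in an element of $\mathcal F$, and (2) for every increasing sequence $(F_i)_{i\ge 1}$ in $\mathcal F$, $\overline{\bigcup_{i=1}^\infty F_i}$ belongs to $\mathcal F$. Suitable models. Formulas are formulas of the language of set theory (ZFC). For a set $N$ and a formula $\varphi$, the relativization $\varphi^N$ is obtained by replacing each quantifier "$\forall x$" by "$\forall x\in N$" and each "$\exists x$" by "$\exists x\in N$". A formula $\varphi(x_1,\dots,x_n)$ (all free variables shown) is absolute for $N$ if for all $a_1,\dots,a_n\in N$, $\varphi^N(a_1,\dots,a_n)\leftrightarrow\varphi(a_1,\dots,a_n)$.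 For a finite list of formulas $\varphi_1,\dots,\varphi_n$ and a countable set $Y$, we write $M\prec(\varphi_1,\dots,\varphi_n;Y)$ ("$M$ is a suitable model for $\varphi_1,\dots,\varphi_n$ containing $Y$") if $M\supset Y$ is a countable set such that $\varphi_1,\dots,\varphi_n$ are absolute for $M$. For a topological space $X$ and such $M$, $X_M:=\overline{X\cap M}$. Statements. A statement $\phi(X,A,f,y_1,\dots,y_k)$ concerning a Banach space $X$, a set $A$ and a function $f$ is a formula $\phi(X,+,\cdot,\|\cdot\|,A,f,y_1,\dots,y_k)$ of the form: "$\langle X,+,\cdot,\|\cdot\|\rangle$ is a Banach space, $A\subset X$, $f$ is a function, $\operatorname{Dom}(f)\subset X$ and $\tilde\phi(X,+,\cdot,\|\cdot\|,A,f,y_1,\dots,y_k)$", for a formula $\tilde\phi(u_1,u_2,u_3,u_4,v,w,y_1,\dots,y_k)$ with all free variables shown. Fix constants $C_1,\dots,C_k$ (arbitrary sets), a Banach space $X$, $A\subset X$ and a function $f$ with $\operatorname{Dom}(f)\subset X$. The statement $\phi(X,A,f,C_1,\dots,C_k)$ is separably determined by the method of rich families if there exists a rich family $\mathcal F$ of separable subspaces of $X$ such that for every $F\in\mathcal F$: $\phi(X,A,f,C_1,\dots,C_k)\Longleftrightarrow\phi(F,A\cap F,f\upharpoonright_F,C_1,\dots,C_k)$. The statement $\phi(X,A,f,C_1,\dots,C_k)$ is separably determined by the method of suitable models if there exist a countable set $Y$ and a finite list of formulas $\varphi_1,\dots,\varphi_n$ such that whenever $M\prec(\varphi_1,\dots,\varphi_n;Y)$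 and $\{X,+,\cdot,\|\cdot\|,A,f,C_1,\dots,C_k\}\subset M$, then $\phi(X,A,f,C_1,\dots,C_k)\Longleftrightarrow\phi(X_M,A\cap X_M,f\upharpoonright_{X_M},C_1,\dots,C_k)$. Fundamental minimal system. For vectors $\{x_i\}_{i\in I}$ in $X$, $[x_i;\ i\in I]$ is their closed linear hull. The family is a fundamental minimal system if $[x_i;\ i\in I]=X$ and $x_i\notin[x_j;\ j\in I,\ j\ne i]$ for every $i\in I$. *)

theory Defs
  imports "HOL-Analysis.Analysis"
begin

section \<open>A universe of sets\<close>

text \<open>
  A type of ZFC sets: \<open>elts x\<close> is the collection of the members of the set \<open>x\<close>, and a
  collection is a set if it lies in \<open>range elts\<close>. Separation and replacement are required
  for arbitrary HOL collections and functions. With the two-valued sequences \<open>g\<close>, the axiom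
  of infinity also gives pairing; the axiom of choice comes from the choice operator of HOL
  and replacement.
\<close>

class zfc_universe =
  fixes elts :: "'a \<Rightarrow> 'a set"
  assumes extensionality: "elts x = elts y \<Longrightarrow> x = y"
    and foundation: "wf {(x, y). x \<in> elts y}"
    and separation: "S \<subseteq> elts x \<Longrightarrow> S \<in> range elts"
    and replacement: "f ` elts x \<in> range elts"
    and union: "\<Union> (elts ` elts x) \<in> range elts"
    and powerset: "{y. elts y \<subseteq> elts x} \<in> range elts"
    and infinity: "range (g :: nat \<Rightarrow> 'a) \<in> range elts"

text \<open>The set with the given members; a junk value if the collection is not a set.\<close>

definition vset :: "'v::zfc_universe set \<Rightarrow> 'v" where
  "vset S = (THE x. elts x = S)"

lemma elts_vset: "S \<in> range elts \<Longrightarrow> elts (vset S) = S"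
  unfolding vset_def by (metis (mono_tags, lifting) extensionality rangeE theI)

lemma vset_elts [simp]: "vset (elts x) = x"
  by (rule extensionality) (simp add: elts_vset)

lemma countable_is_set:
  assumes "countable S"
  shows "S \<in> range (elts :: 'v::zfc_universe \<Rightarrow> 'v set)"
proof (cases "S = {}")
  case True
  then show ?thesis using separation[of "{}"] by simp
next
  case False
  then obtain g :: "nat \<Rightarrow> 'v" where "range g = S"
    using assms by (metis uncountable_def)
  then show ?thesis using infinity[of g] by simp
qed

definition vpair :: "'v::zfc_universe \<Rightarrow> 'v \<Rightarrow> 'v" where
  "vpair a b = vset {vset {a}, vset {a, b}}"

lemma vpair_inject [simp]: "vpair a b = vpair c d \<longleftrightarrow> a = c \<and> b = d"
proof
  have e: "elts (vset S) = S" if "finite S" for S :: "'a set"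
    by (rule elts_vset[OF countable_is_set[OF countable_finite[OF that]]])
  assume "vpair a b = vpair c d"
  then have "{vset {a}, vset {a, b}} = {vset {c}, vset {c, d}}"
    unfolding vpair_def by (metis e finite.emptyI finite_insert)
  then have "elts ` {vset {a}, vset {a, b}} = elts ` {vset {c}, vset {c, d}}" by simp
  then have "{{a}, {a, b}} = {{c}, {c, d}}" by (simp add: e)
  then show "a = c \<and> b = d" by (simp add: doubleton_eq_iff) blast
qed simp

definition vtimes :: "'v::zfc_universe set \<Rightarrow> 'v set \<Rightarrow> 'v set" where
  "vtimes S T = {vpair x y |x y. x \<in> S \<and> y \<in> T}"

definition vfunction :: "'v::zfc_universe \<Rightarrow> bool" where
  "vfunction f \<longleftrightarrow> (\<forall>z\<in>elts f. \<exists>x y. z = vpair x y) \<and>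
    (\<forall>x y y'. vpair x y \<in> elts f \<longrightarrow> vpair x y' \<in> elts f \<longrightarrow> y = y')"

definition vdom :: "'v::zfc_universe \<Rightarrow> 'v set" where
  "vdom f = {x. \<exists>y. vpair x y \<in> elts f}"

definition vapp :: "'v::zfc_universe \<Rightarrow> 'v \<Rightarrow> 'v" where
  "vapp f x = (THE y. vpair x y \<in> elts f)"

definition vfun_from_to :: "'v::zfc_universe \<Rightarrow> 'v set \<Rightarrow> 'v set \<Rightarrow> bool" where
  "vfun_from_to f S T \<longleftrightarrow> vfunction f \<and> vdom f = S \<and> (\<forall>x\<in>S. vapp f x \<in> T)"

definition vrestrict :: "'v::zfc_universe \<Rightarrow> 'v set \<Rightarrow> 'v" where
  "vrestrict f S = vset {vpair x y |x y. x \<in> S \<and> vpair x y \<in> elts f}"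


section \<open>The real numbers as sets\<close>

text \<open>
  Von Neumann natural numbers; an integer is the pair (positive part, negative part); a
  rational is the pair (numerator, denominator) in lowest terms with positive denominator; a
  real number is its left Dedekind cut.
\<close>

primrec vnat :: "nat \<Rightarrow> 'v::zfc_universe" where
  "vnat 0 = vset {}"
| "vnat (Suc k) = vset (insert (vnat k) (elts (vnat k)))"

definition vint :: "int \<Rightarrow> 'v::zfc_universe" where
  "vint i = vpair (vnat (nat i)) (vnat (nat (- i)))"

definition vrat :: "rat \<Rightarrow> 'v::zfc_universe" where
  "vrat q = vpair (vint (fst (quotient_of q))) (vint (snd (quotient_of q)))"

definition vreal :: "real \<Rightarrow> 'v::zfc_universe" where
  "vreal r = vset (vrat ` {q. of_rat q < r})"

definition real_of_v :: "'v::zfc_universe \<Rightarrow> real" where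
  "real_of_v = inv vreal"

lemma elts_vnat: "elts (vnat k :: 'v::zfc_universe) = vnat ` {..<k}"
proof (induction k)
  case 0
  then show ?case by (simp add: elts_vset countable_is_set)
next
  case (Suc k)
  then show ?case by (simp add: elts_vset countable_is_set lessThan_Suc)
qed

lemma inj_vnat: "inj (vnat :: nat \<Rightarrow> 'v::zfc_universe)"
proof (rule linorder_injI)
  fix i j :: nat
  assume "i < j"
  then have "(vnat i :: 'v) \<in> elts (vnat j)" by (auto simp: elts_vnat)
  moreover have "(x :: 'v) \<notin> elts x" for x
    using wf_not_refl[OF foundation] by blast
  ultimately show "(vnat i :: 'v) \<noteq> vnat j" by metis
qed

lemma inj_vrat: "inj (vrat :: rat \<Rightarrow> 'v::zfc_universe)"
proof -
  have "i = j" if "(vint i :: 'v) = vint j" for i j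
    using that by (auto simp: vint_def inj_eq[OF inj_vnat])
  then show ?thesis
    by (intro injI) (metis vrat_def vpair_inject prod.expand quotient_of_inject)
qed

lemma inj_vreal: "inj (vreal :: real \<Rightarrow> 'v::zfc_universe)"
proof (rule linorder_injI)
  fix r s :: real
  assume "r < s"
  then obtain q where q: "r < of_rat q" "of_rat q < s" using of_rat_dense by blast
  have e: "elts (vreal t :: 'v) = vrat ` {q. of_rat q < t}" for t
    unfolding vreal_def by (simp add: elts_vset countable_is_set)
  have "(vrat q :: 'v) \<in> elts (vreal s)" "(vrat q :: 'v) \<notin> elts (vreal r)"
    using q by (auto simp: e inj_eq[OF inj_vrat])
  then show "(vreal r :: 'v) \<noteq> vreal s" by metis
qed

lemma real_of_v_vreal [simp]: "real_of_v (vreal r) = r"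
  by (simp add: real_of_v_def inj_vreal)


section \<open>Banach spaces as sets\<close>

text \<open>
  A normed space is given by sets \<open>X\<close>, \<open>p\<close>, \<open>m\<close>, \<open>nn\<close>: the underlying set and the functions
  (sets of ordered pairs) \<open>p : X \<times> X \<rightarrow> X\<close>, \<open>m : \<real> \<times> X \<rightarrow> X\<close> and \<open>nn : X \<rightarrow> \<real>\<close>.
\<close>

definition vadd :: "'v::zfc_universe \<Rightarrow> 'v \<Rightarrow> 'v \<Rightarrow> 'v" where
  "vadd p x y = vapp p (vpair x y)"

definition vscale :: "'v::zfc_universe \<Rightarrow> real \<Rightarrow> 'v \<Rightarrow> 'v" where
  "vscale m r x = vapp m (vpair (vreal r) x)"

definition vnorm :: "'v::zfc_universe \<Rightarrow> 'v \<Rightarrow> real" where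
  "vnorm nn x = real_of_v (vapp nn x)"

locale real_normed_space_on =
  fixes S :: "'a set" and add :: "'a \<Rightarrow> 'a \<Rightarrow> 'a" and zero :: 'a
    and scale :: "real \<Rightarrow> 'a \<Rightarrow> 'a" and nrm :: "'a \<Rightarrow> real"
  assumes zero_closed: "zero \<in> S"
    and add_closed: "x \<in> S \<Longrightarrow> y \<in> S \<Longrightarrow> add x y \<in> S"
    and scale_closed: "x \<in> S \<Longrightarrow> scale r x \<in> S"
    and add_assoc: "x \<in> S \<Longrightarrow> y \<in> S \<Longrightarrow> z \<in> S \<Longrightarrow> add (add x y) z = add x (add y z)"
    and add_commute: "x \<in> S \<Longrightarrow> y \<in> S \<Longrightarrow> add x y = add y x"
    and add_zero: "x \<in> S \<Longrightarrow> add x zero = x"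
    and add_inverse: "x \<in> S \<Longrightarrow> \<exists>y\<in>S. add x y = zero"
    and scale_add_right: "x \<in> S \<Longrightarrow> y \<in> S \<Longrightarrow> scale r (add x y) = add (scale r x) (scale r y)"
    and scale_add_left: "x \<in> S \<Longrightarrow> scale (r + t) x = add (scale r x) (scale t x)"
    and scale_scale: "x \<in> S \<Longrightarrow> scale r (scale t x) = scale (r * t) x"
    and scale_one: "x \<in> S \<Longrightarrow> scale 1 x = x"
    and norm_nonneg: "x \<in> S \<Longrightarrow> 0 \<le> nrm x"
    and norm_eq_zero: "x \<in> S \<Longrightarrow> nrm x = 0 \<longleftrightarrow> x = zero"
    and norm_triangle: "x \<in> S \<Longrightarrow> y \<in> S \<Longrightarrow> nrm (add x y) \<le> nrm x + nrm y"
    and norm_scale: "x \<in> S \<Longrightarrow> nrm (scale r x) = \<bar>r\<bar> * nrm x"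

text \<open>The value off \<open>X\<close> is \<open>0\<close> because \<open>Metric_space\<close> asks for a nonnegative symmetric
  function on the whole type.\<close>

definition vdist :: "'v::zfc_universe \<Rightarrow> 'v \<Rightarrow> 'v \<Rightarrow> 'v \<Rightarrow> 'v \<Rightarrow> 'v \<Rightarrow> real" where
  "vdist X p m nn x y =
    (if x \<in> elts X \<and> y \<in> elts X then vnorm nn (vadd p x (vscale m (- 1) y)) else 0)"

definition norm_topology :: "'v::zfc_universe \<Rightarrow> 'v \<Rightarrow> 'v \<Rightarrow> 'v \<Rightarrow> 'v topology" where
  "norm_topology X p m nn = Metric_space.mtopology (elts X) (vdist X p m nn)"

definition banach_space :: "'v::zfc_universe \<Rightarrow> 'v \<Rightarrow> 'v \<Rightarrow> 'v \<Rightarrow> bool" where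
  "banach_space X p m nn \<longleftrightarrow>
    vfun_from_to p (vtimes (elts X) (elts X)) (elts X) \<and>
    vfun_from_to m (vtimes (range vreal) (elts X)) (elts X) \<and>
    vfun_from_to nn (elts X) (range vreal) \<and>
    (\<exists>zero. real_normed_space_on (elts X) (vadd p) zero (vscale m) (vnorm nn)) \<and>
    Metric_space.mcomplete (elts X) (vdist X p m nn)"

text \<open>Subspaces of a Banach space are understood to be closed and linear.\<close>

definition closed_subspace :: "'v::zfc_universe \<Rightarrow> 'v \<Rightarrow> 'v \<Rightarrow> 'v \<Rightarrow> 'v set \<Rightarrow> bool" where
  "closed_subspace X p m nn F \<longleftrightarrow>
    F \<noteq> {} \<and> closedin (norm_topology X p m nn) F \<and>
    (\<forall>x\<in>F. \<forall>y\<in>F. vadd p x y \<in> F) \<and> (\<forall>r. \<forall>x\<in>F. vscale m r x \<in> F)"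

definition separable_subspace :: "'v::zfc_universe \<Rightarrow> 'v \<Rightarrow> 'v \<Rightarrow> 'v \<Rightarrow> 'v set \<Rightarrow> bool" where
  "separable_subspace X p m nn F \<longleftrightarrow>
    closed_subspace X p m nn F \<and> separable_space (subtopology (norm_topology X p m nn) F)"

definition closed_linear_hull :: "'v::zfc_universe \<Rightarrow> 'v \<Rightarrow> 'v \<Rightarrow> 'v \<Rightarrow> 'v set \<Rightarrow> 'v set" where
  "closed_linear_hull X p m nn S = closed_subspace X p m nn hull S"

definition fundamental_minimal_system ::
    "'v::zfc_universe \<Rightarrow> 'v \<Rightarrow> 'v \<Rightarrow> 'v \<Rightarrow> 'i set \<Rightarrow> ('i \<Rightarrow> 'v) \<Rightarrow> bool" where
  "fundamental_minimal_system X p m nn I x \<longleftrightarrow>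
    x ` I \<subseteq> elts X \<and>
    closed_linear_hull X p m nn (x ` I) = elts X \<and>
    (\<forall>i\<in>I. x i \<notin> closed_linear_hull X p m nn (x ` (I - {i})))"

unbundle cardinal_syntax

text \<open>The least cardinality of a dense subset is \<open>\<kappa>\<close>.\<close>

definition has_density :: "'a topology \<Rightarrow> 'b rel \<Rightarrow> bool" where
  "has_density T \<kappa> \<longleftrightarrow>
    (\<exists>D \<subseteq> topspace T. T closure_of D = topspace T \<and> |D| =o \<kappa>) \<and>
    (\<forall>D \<subseteq> topspace T. T closure_of D = topspace T \<longrightarrow> \<kappa> \<le>o |D| )"

definition aleph1 :: "nat set rel" where
  "aleph1 = cardSuc natLeq"


section \<open>Formulas of the language of set theory\<close>

datatype fm =
    FMem nat nat
  | FEq nat nat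
  | FNeg fm
  | FAnd fm fm
  | FOr fm fm
  | FImp fm fm
  | FAll nat fm
  | FEx nat fm

primrec fv :: "fm \<Rightarrow> nat set" where
  "fv (FMem i j) = {i, j}"
| "fv (FEq i j) = {i, j}"
| "fv (FNeg a) = fv a"
| "fv (FAnd a b) = fv a \<union> fv b"
| "fv (FOr a b) = fv a \<union> fv b"
| "fv (FImp a b) = fv a \<union> fv b"
| "fv (FAll i a) = fv a - {i}"
| "fv (FEx i a) = fv a - {i}"

text \<open>\<open>sat N e a\<close> is the truth of the relativization of \<open>a\<close> to \<open>N\<close> under the assignment \<open>e\<close>;
  with \<open>N = UNIV\<close> it is the truth of \<open>a\<close> itself.\<close>

primrec sat :: "'v::zfc_universe set \<Rightarrow> (nat \<Rightarrow> 'v) \<Rightarrow> fm \<Rightarrow> bool" where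
  "sat N e (FMem i j) \<longleftrightarrow> e i \<in> elts (e j)"
| "sat N e (FEq i j) \<longleftrightarrow> e i = e j"
| "sat N e (FNeg a) \<longleftrightarrow> \<not> sat N e a"
| "sat N e (FAnd a b) \<longleftrightarrow> sat N e a \<and> sat N e b"
| "sat N e (FOr a b) \<longleftrightarrow> sat N e a \<or> sat N e b"
| "sat N e (FImp a b) \<longleftrightarrow> (sat N e a \<longrightarrow> sat N e b)"
| "sat N e (FAll i a) \<longleftrightarrow> (\<forall>x\<in>N. sat N (e(i := x)) a)"
| "sat N e (FEx i a) \<longleftrightarrow> (\<exists>x\<in>N. sat N (e(i := x)) a)"

definition absolute_for :: "fm \<Rightarrow> 'v::zfc_universe set \<Rightarrow> bool" where
  "absolute_for a N \<longleftrightarrow> (\<forall>e. (\<forall>i\<in>fv a. e i \<in> N) \<longrightarrow> (sat N e a \<longleftrightarrow> sat UNIV e a))"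

text \<open>Countable collections are sets, so suitable models may be taken as HOL sets.\<close>

definition suitable_model :: "'v::zfc_universe set \<Rightarrow> fm list \<Rightarrow> 'v set \<Rightarrow> bool" where
  "suitable_model M as Y \<longleftrightarrow> countable M \<and> Y \<subseteq> M \<and> (\<forall>a\<in>set as. absolute_for a M)"


section \<open>Statements and separable determination\<close>

text \<open>The truth of the statement whose last conjunct is the formula \<open>a\<close>. The variables
  \<open>0, \<dots>, 5\<close> of \<open>a\<close> stand for \<open>X, +, \<cdot>, norm, A, f\<close>, and the variables from \<open>6\<close> on
  for the constants.\<close>

definition statement_holds ::
    "fm \<Rightarrow> 'v::zfc_universe \<Rightarrow> 'v \<Rightarrow> 'v \<Rightarrow> 'v \<Rightarrow> 'v \<Rightarrow> 'v \<Rightarrow> 'v list \<Rightarrow> bool" where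
  "statement_holds a X p m nn A f Cs \<longleftrightarrow>
    banach_space X p m nn \<and> elts A \<subseteq> elts X \<and> vfunction f \<and> vdom f \<subseteq> elts X \<and>
    sat UNIV (\<lambda>i. ([X, p, m, nn, A, f] @ Cs) ! i) a"

text \<open>The statement for \<open>F\<close> with the restricted operations and norm, \<open>A \<inter> F\<close> and the
  restriction of \<open>f\<close> to \<open>F\<close>.\<close>

definition statement_holds_on ::
    "fm \<Rightarrow> 'v::zfc_universe \<Rightarrow> 'v \<Rightarrow> 'v \<Rightarrow> 'v \<Rightarrow> 'v \<Rightarrow> 'v list \<Rightarrow> 'v set \<Rightarrow> bool" where
  "statement_holds_on a p m nn A f Cs F \<longleftrightarrow>
    statement_holds a (vset F) (vrestrict p (vtimes F F)) (vrestrict m (vtimes (range vreal) F))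
      (vrestrict nn F) (vset (elts A \<inter> F)) (vrestrict f F) Cs"

definition rich_family ::
    "'v::zfc_universe \<Rightarrow> 'v \<Rightarrow> 'v \<Rightarrow> 'v \<Rightarrow> 'v set set \<Rightarrow> bool" where
  "rich_family X p m nn \<F> \<longleftrightarrow>
    (\<forall>F\<in>\<F>. separable_subspace X p m nn F) \<and>
    (\<forall>S. separable_subspace X p m nn S \<longrightarrow> (\<exists>F\<in>\<F>. S \<subseteq> F)) \<and>
    (\<forall>F :: nat \<Rightarrow> 'v set. incseq F \<longrightarrow> range F \<subseteq> \<F> \<longrightarrow>
      norm_topology X p m nn closure_of (\<Union>i. F i) \<in> \<F>)"

definition sep_det_by_rich_families ::
    "fm \<Rightarrow> 'v::zfc_universe \<Rightarrow> 'v \<Rightarrow> 'v \<Rightarrow> 'v \<Rightarrow> 'v \<Rightarrow> 'v \<Rightarrow> 'v list \<Rightarrow> bool" where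
  "sep_det_by_rich_families a X p m nn A f Cs \<longleftrightarrow>
    (\<exists>\<F>. rich_family X p m nn \<F> \<and>
      (\<forall>F\<in>\<F>. statement_holds a X p m nn A f Cs \<longleftrightarrow> statement_holds_on a p m nn A f Cs F))"

definition sep_det_by_suitable_models ::
    "fm \<Rightarrow> 'v::zfc_universe \<Rightarrow> 'v \<Rightarrow> 'v \<Rightarrow> 'v \<Rightarrow> 'v \<Rightarrow> 'v \<Rightarrow> 'v list \<Rightarrow> bool" where
  "sep_det_by_suitable_models a X p m nn A f Cs \<longleftrightarrow>
    (\<exists>Y as. countable Y \<and>
      (\<forall>M. suitable_model M as Y \<longrightarrow> {X, p, m, nn, A, f} \<union> set Cs \<subseteq> M \<longrightarrow>
        (statement_holds a X p m nn A f Cs \<longleftrightarrow>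
         statement_holds_on a p m nn A f Cs
           (norm_topology X p m nn closure_of (elts X \<inter> M)))))"

end

theory Submission
  imports Defs "HOL-Library.Countable_Set_Type"
begin

text \<open>
  The two methods are linked by the spaces \<open>X\<^sub>M\<close>, the closures of \<open>X \<inter> M\<close> for countable \<open>M\<close>: it
  suffices to compare a rich family with the collection of the spaces \<open>X\<^sub>M\<close> of suitable models.

  Rich families give suitable models for every \<open>X\<close>. Given a rich family, choose functions that
  assign to a point a member containing it, to two members a larger third one, and to a member
  a dense sequence in it. A suitable model that contains these functions is closed under them, so its
  members in the family form a countable directed system whose union is dense in \<open>X\<^sub>M\<close>; hence \<open>X\<^sub>M\<close>
  is itself in the family (\<open>rich_family_model_codes\<close>).

  Conversely, suitable models are produced as Skolem hulls \<open>H(C)\<close> of countable subsets \<open>C\<close> of an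
  index set \<open>J\<close>. Hulls under finitary functions commute with unions of chains, so the spaces
  \<open>X\<^bsub>H(C)\<^esub>\<close> are closed under increasing limits as soon as inclusion of two of these spaces makes
  the two hulls comparable (\<open>rich_family_of_hulls\<close>). The extra hypothesis on \<open>X\<close> provides a set \<open>J\<close>
  with this property that is also large enough for every separable subspace to lie in some
  \<open>X\<^bsub>H(C)\<^esub>\<close>. With a fundamental minimal system, \<open>J\<close> is its index set, \<open>X\<^sub>M\<close> is spanned by the
  vectors with index in \<open>J \<inter> M\<close>, and minimality recovers \<open>J \<inter> M\<close>, hence the hull, from \<open>X\<^sub>M\<close>.
  With density \<open>\<aleph>\<^sub>1\<close>, \<open>J\<close> is a dense set well-ordered in type \<open>\<omega>\<^sub>1\<close>; models closed under
  enumerations of the countable initial segments meet \<open>J\<close> in initial segments, so any two hulls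
  are comparable.
\<close>

section \<open>The metric of a normed space given on a set\<close>

context real_normed_space_on
begin

definition diff_norm :: "'a \<Rightarrow> 'a \<Rightarrow> real" where
  "diff_norm x y = nrm (add x (scale (- 1) y))"

lemma add_left_commute:
  "x \<in> S \<Longrightarrow> y \<in> S \<Longrightarrow> z \<in> S \<Longrightarrow> add x (add y z) = add y (add x z)"
  by (metis add_assoc add_commute)

lemmas closed = zero_closed add_closed scale_closed
lemmas add_ac = add_assoc add_commute add_left_commute

lemma scale_zero: "x \<in> S \<Longrightarrow> scale 0 x = zero"
  using norm_scale[of x 0] norm_eq_zero[of "scale 0 x"] by (simp add: closed)

lemma add_neg: "x \<in> S \<Longrightarrow> add x (scale (- 1) x) = zero"
  using scale_add_left[of x 1 "- 1"] by (simp add: scale_one scale_zero)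

lemma add_neg_left: "x \<in> S \<Longrightarrow> add (scale (- 1) x) x = zero"
  by (simp add: add_commute[of "scale (- 1) x"] add_neg closed)

lemma zero_add: "x \<in> S \<Longrightarrow> add zero x = x"
  using add_commute[of zero x] by (simp add: add_zero closed)

lemma diff_norm_commute:
  assumes "x \<in> S" "y \<in> S"
  shows "diff_norm x y = diff_norm y x"
proof -
  have "scale (- 1) (add x (scale (- 1) y)) = add y (scale (- 1) x)"
    using assms by (simp add: scale_add_right scale_scale scale_one closed add_commute[of _ y])
  then show ?thesis
    using norm_scale[of "add x (scale (- 1) y)" "- 1"] assms by (simp add: diff_norm_def closed)
qed

lemma diff_norm_eq_0:
  assumes "x \<in> S" "y \<in> S"
  shows "diff_norm x y = 0 \<longleftrightarrow> x = y"
proof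
  assume "diff_norm x y = 0"
  then have "add (add x (scale (- 1) y)) y = y"
    using assms by (simp add: diff_norm_def norm_eq_zero closed zero_add)
  then show "x = y"
    using assms by (simp add: add_assoc add_neg_left add_zero closed)
qed (use assms in \<open>simp add: diff_norm_def add_neg norm_eq_zero zero_closed\<close>)

lemma diff_norm_triangle:
  assumes "x \<in> S" "y \<in> S" "z \<in> S"
  shows "diff_norm x z \<le> diff_norm x y + diff_norm y z"
proof -
  have "add (add x (scale (- 1) y)) (add y (scale (- 1) z))
      = add x (add (add (scale (- 1) y) y) (scale (- 1) z))"
    using assms by (simp add: add_assoc closed)
  also have "\<dots> = add x (scale (- 1) z)"
    using assms by (simp add: add_neg_left zero_add closed)
  finally show ?thesis
    using norm_triangle[of "add x (scale (- 1) y)" "add y (scale (- 1) z)"] assms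
    by (simp add: diff_norm_def closed)
qed

lemma diff_norm_add:
  assumes "x \<in> S" "y \<in> S" "x' \<in> S" "y' \<in> S"
  shows "diff_norm (add x y) (add x' y') \<le> diff_norm x x' + diff_norm y y'"
proof -
  have "add (add x y) (scale (- 1) (add x' y'))
      = add (add x (scale (- 1) x')) (add y (scale (- 1) y'))"
    using assms by (simp add: scale_add_right closed add_ac)
  then show ?thesis
    using norm_triangle[of "add x (scale (- 1) x')" "add y (scale (- 1) y')"] assms
    by (simp add: diff_norm_def closed)
qed

lemma diff_norm_scale:
  assumes "x \<in> S" "x' \<in> S"
  shows "diff_norm (scale r x) (scale q x') \<le> \<bar>r - q\<bar> * nrm x + \<bar>q\<bar> * diff_norm x x'"
proof -
  have "diff_norm (scale r x) (scale q x)  = nrm (scale (r - q) x)"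
    using assms scale_add_left[of x r "- q"] by (simp add: diff_norm_def scale_scale)
  moreover have "add (scale q x) (scale (- 1) (scale q x')) = scale q (add x (scale (- 1) x'))"
    using assms by (simp add: scale_add_right scale_scale closed mult.commute)
  ultimately show ?thesis
    using diff_norm_triangle[of "scale r x" "scale q x" "scale q x'"] assms
      norm_scale[of x "r - q"] norm_scale[of "add x (scale (- 1) x')" q]
    by (simp add: diff_norm_def closed)
qed

end


section \<open>Banach spaces inside the universe\<close>

locale vbanach =
  fixes X p m nn :: "'v::zfc_universe"
  assumes banach: "banach_space X p m nn"
begin

abbreviation T :: "'v topology" where "T \<equiv> norm_topology X p m nn"
abbreviation cl :: "'v set \<Rightarrow> 'v set" where "cl S \<equiv> T closure_of S"
abbreviation clsub :: "'v set \<Rightarrow> bool" where "clsub \<equiv> closed_subspace X p m nn"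
abbreviation sepsub :: "'v set \<Rightarrow> bool" where "sepsub \<equiv> separable_subspace X p m nn"
abbreviation clin :: "'v set \<Rightarrow> 'v set" where "clin \<equiv> closed_linear_hull X p m nn"

definition vzero :: 'v where
  "vzero = (SOME z. real_normed_space_on (elts X) (vadd p) z (vscale m) (vnorm nn))"

sublocale real_normed_space_on "elts X" "vadd p" vzero "vscale m" "vnorm nn"
  unfolding vzero_def by (rule someI_ex) (use banach in \<open>simp add: banach_space_def\<close>)

lemma vdist_eq: "x \<in> elts X \<Longrightarrow> y \<in> elts X \<Longrightarrow> vdist X p m nn x y = diff_norm x y"
  by (simp add: vdist_def diff_norm_def)

sublocale Metric_space "elts X" "vdist X p m nn"
proof
  fix x y z
  show "0 \<le> vdist X p m nn x y" by (simp add: vdist_def norm_nonneg closed)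
  show "vdist X p m nn x y = vdist X p m nn y x"
    using diff_norm_commute by (metis vdist_def vdist_eq)
  show "vdist X p m nn x z \<le> vdist X p m nn x y + vdist X p m nn y z"
    if "x \<in> elts X" "y \<in> elts X" "z \<in> elts X"
    using that by (simp add: vdist_eq diff_norm_triangle)
qed (simp add: vdist_eq diff_norm_eq_0)

lemma topspace_T [simp]: "topspace T = elts X"
  by (simp add: norm_topology_def)

lemma in_cl_iff:
  assumes "S \<subseteq> elts X"
  shows "x \<in> cl S \<longleftrightarrow> x \<in> elts X \<and> (\<forall>\<epsilon>>0. \<exists>y\<in>S. diff_norm x y < \<epsilon>)"
proof -
  have "x \<in> elts X \<Longrightarrow> y \<in> S \<Longrightarrow> y \<in> mball x \<epsilon> \<longleftrightarrow> diff_norm x y < \<epsilon>" for y \<epsilon>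
    using assms by (auto simp: in_mball vdist_eq subset_iff)
  then show ?thesis
    unfolding norm_topology_def metric_closure_of by blast
qed

lemma cl_approx:
  assumes "S \<subseteq> elts X" "x \<in> cl S" "0 < \<epsilon>"
  obtains y where "y \<in> S" "y \<in> elts X" "x \<in> elts X" "diff_norm x y < \<epsilon>"
  using assms in_cl_iff[OF assms(1)] by blast

text \<open>Rational scalars suffice because \<open>r x - q x' = (r - q) x + q (x - x')\<close> is small when
  \<open>q\<close> is close to \<open>r\<close> and \<open>x'\<close> is close to \<open>x\<close>. Models are countable, so they cannot be
  closed under all real scalars.\<close>

lemma closed_subspace_closure_rational:
  assumes S: "S \<subseteq> elts X" "S \<noteq> {}"
    and add: "\<And>x y. x \<in> S \<Longrightarrow> y \<in> S \<Longrightarrow> vadd p x y \<in> S"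
    and scale: "\<And>q x. x \<in> S \<Longrightarrow> vscale m (of_rat q) x \<in> S"
  shows "clsub (cl S)"
  unfolding closed_subspace_def
proof (intro conjI ballI allI)
  have "S \<subseteq> cl S" using S by (simp add: closure_of_subset)
  then show "cl S \<noteq> {}" using S by auto
  show "closedin T (cl S)" by simp
next
  fix x y assume x: "x \<in> cl S" and y: "y \<in> cl S"
  have xy: "x \<in> elts X" "y \<in> elts X" using x y in_cl_iff[OF S(1)] by auto
  have "\<exists>z\<in>S. diff_norm (vadd p x y) z < \<epsilon>" if "0 < \<epsilon>" for \<epsilon>
  proof -
    have e: "0 < \<epsilon> / 2" using that by simp
    obtain x' where x': "x' \<in> S" "x' \<in> elts X" "diff_norm x x' < \<epsilon>/2"
      using cl_approx[OF S(1) x e] by blast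
    obtain y' where y': "y' \<in> S" "y' \<in> elts X" "diff_norm y y' < \<epsilon>/2"
      using cl_approx[OF S(1) y e] by blast
    have "diff_norm (vadd p x y) (vadd p x' y') < \<epsilon>"
      using diff_norm_add[of x y x' y'] x' y' xy by simp
    then show ?thesis using add[OF x'(1) y'(1)] by blast
  qed
  then show "vadd p x y \<in> cl S" using xy by (simp add: in_cl_iff[OF S(1)] closed)
next
  fix r x assume x: "x \<in> cl S"
  have xX: "x \<in> elts X" using x in_cl_iff[OF S(1)] by auto
  have "\<exists>z\<in>S. diff_norm (vscale m r x) z < \<epsilon>" if e: "0 < \<epsilon>" for \<epsilon>
  proof -
    define K where "K = vnorm nn x + 1"
    have K: "K > 0" "vnorm nn x \<le> K" using norm_nonneg[of x] xX by (simp_all add: K_def)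
    obtain q where q: "r < of_rat q" "of_rat q < r + min 1 (\<epsilon> / (2 * K))"
      using of_rat_dense[of r "r + min 1 (\<epsilon> / (2 * K))"] e K by auto
    define L where "L = \<bar>r\<bar> + 1"
    have L: "L > 0" "\<bar>of_rat q\<bar> \<le> L" using q unfolding L_def by linarith+
    have "0 < \<epsilon> / (2 * L)" using e L by simp
    then obtain x' where x': "x' \<in> S" "x' \<in> elts X" "diff_norm x x' < \<epsilon> / (2 * L)"
      using cl_approx[OF S(1) x] by blast
    have nn: "0 \<le> diff_norm x x'" using xX x' by (simp add: diff_norm_def norm_nonneg closed)
    have "\<bar>r - of_rat q\<bar> * vnorm nn x \<le> \<epsilon> / (2 * K) * K"
      using q K norm_nonneg[of x] xX by (intro mult_mono) auto
    moreover have "\<bar>of_rat q\<bar> * diff_norm x x' \<le> L * diff_norm x x'"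
      using L nn by (intro mult_right_mono) auto
    moreover have "L * diff_norm x x' < L * (\<epsilon> / (2 * L))"
      using L x' by (intro mult_strict_left_mono) auto
    ultimately have "diff_norm (vscale m r x) (vscale m (of_rat q) x') < \<epsilon>"
      using diff_norm_scale[of x x' r "of_rat q"] xX x' K L by simp
    then show ?thesis using scale[OF x'(1)] by blast
  qed
  then show "vscale m r x \<in> cl S" using xX by (simp add: in_cl_iff[OF S(1)] closed)
qed

lemma closed_subspace_closure:
  assumes "S \<subseteq> elts X" "S \<noteq> {}" "\<And>x y. x \<in> S \<Longrightarrow> y \<in> S \<Longrightarrow> vadd p x y \<in> S"
    and "\<And>r x. x \<in> S \<Longrightarrow> vscale m r x \<in> S"
  shows "clsub (cl S)"
  using assms by (intro closed_subspace_closure_rational)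

lemma closed_subspace_subset: "clsub F \<Longrightarrow> F \<subseteq> elts X"
  unfolding closed_subspace_def using closedin_subset topspace_T by metis

lemma closed_subspace_cl: "clsub F \<Longrightarrow> cl F = F"
  by (simp add: closed_subspace_def closure_of_closedin)

lemma cl_subset_closed_subspace: "clsub F \<Longrightarrow> S \<subseteq> F \<Longrightarrow> cl S \<subseteq> F"
  using closed_subspace_cl closure_of_mono by metis

lemma zero_in_closed_subspace:
  assumes "clsub F" shows "vzero \<in> F"
proof -
  obtain x where "x \<in> F" using assms by (auto simp: closed_subspace_def)
  moreover then have "x \<in> elts X" using closed_subspace_subset[OF assms] by auto
  ultimately show ?thesis using assms scale_zero[of x] by (metis closed_subspace_def)
qed

lemma closed_subspace_Inter:
  assumes "\<F> \<noteq> {}" "\<And>F. F \<in> \<F> \<Longrightarrow> clsub F"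
  shows "clsub (\<Inter>\<F>)"
  unfolding closed_subspace_def
proof (intro conjI ballI allI)
  show "\<Inter>\<F> \<noteq> {}" using zero_in_closed_subspace assms by blast
  show "closedin T (\<Inter>\<F>)" using assms by (intro closedin_Inter) (auto simp: closed_subspace_def)
qed (use assms in \<open>auto simp: closed_subspace_def\<close>)

lemma closed_subspace_whole: "clsub (elts X)"
  using closedin_topspace[of T] closed by (auto simp: closed_subspace_def)

lemma closed_subspace_clin:
  assumes "S \<subseteq> elts X"
  shows "clsub (clin S)"
  unfolding closed_linear_hull_def hull_def
  by (rule closed_subspace_Inter) (use assms closed_subspace_whole in auto)

lemma clin_superset: "S \<subseteq> clin S"
  unfolding closed_linear_hull_def by (rule hull_subset)

lemma clin_mono: "S \<subseteq> S' \<Longrightarrow> clin S \<subseteq> clin S'"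
  unfolding closed_linear_hull_def by (rule hull_mono)

lemma clin_minimal: "S \<subseteq> F \<Longrightarrow> clsub F \<Longrightarrow> clin S \<subseteq> F"
  unfolding closed_linear_hull_def by (rule hull_minimal)

lemma cl_countably_supported:
  assumes "S \<subseteq> elts X" "x \<in> cl S"
  obtains C where "countable C" "C \<subseteq> S" "x \<in> cl C"
proof -
  have "\<exists>y\<in>S. diff_norm x y < inverse (Suc n)" for n
    using assms(2) unfolding in_cl_iff[OF assms(1)] by simp
  then obtain y where y: "\<And>n. y n \<in> S" "\<And>n. diff_norm x (y n) < inverse (Suc n)" by metis
  have "\<exists>z\<in>range y. diff_norm x z < \<epsilon>" if "\<epsilon> > 0" for \<epsilon>
    using reals_Archimedean[OF that] y(2) by (meson less_trans rangeI)
  moreover have "range y \<subseteq> elts X" using y assms by auto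
  ultimately have "x \<in> cl (range y)"
    using in_cl_iff[of "range y" x] in_cl_iff[OF assms(1)] assms(2) by blast
  then show thesis using y(1) by (intro that[of "range y"]) auto
qed

text \<open>The vectors with countable support form a closed linear subspace, since countably many of them
  have a common countable support and a point of a closure lies in the closure of a countable subset.\<close>

lemma clin_countably_supported:
  assumes S: "S \<subseteq> elts X" and "x \<in> clin S"
  obtains C where "countable C" "C \<subseteq> S" "x \<in> clin C"
proof -
  define U where "U = (\<Union>C\<in>{C. countable C \<and> C \<subseteq> S}. clin C)"
  have U: "\<exists>C. countable C \<and> C \<subseteq> S \<and> D \<subseteq> clin C" if D: "countable D" "D \<subseteq> U" for D
  proof -
    have "\<forall>x\<in>D. \<exists>C. countable C \<and> C \<subseteq> S \<and> x \<in> clin C"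
      using D(2) unfolding U_def by blast
    then obtain c where c: "\<forall>x\<in>D. countable (c x) \<and> c x \<subseteq> S \<and> x \<in> clin (c x)"
      using bchoice by metis
    have "D \<subseteq> clin (\<Union>x\<in>D. c x)"
    proof
      fix x assume "x \<in> D"
      then have "clin (c x) \<subseteq> clin (\<Union>x\<in>D. c x)" by (intro clin_mono) auto
      then show "x \<in> clin (\<Union>x\<in>D. c x)" using c \<open>x \<in> D\<close> by auto
    qed
    then show ?thesis using c D(1) by (intro exI[of _ "\<Union>x\<in>D. c x"]) auto
  qed
  have sub: "clsub (clin C)" if "C \<subseteq> S" for C
    using that S by (intro closed_subspace_clin) auto
  have UX: "U \<subseteq> elts X"
    unfolding U_def by (intro UN_least closed_subspace_subset sub) simp
  have UI: "y \<in> U" if D: "D \<subseteq> U" "countable D" and y: "\<And>F. clsub F \<Longrightarrow> D \<subseteq> F \<Longrightarrow> y \<in> F" for D y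
  proof -
    obtain C where "countable C" "C \<subseteq> S" "D \<subseteq> clin C" using U[OF D(2,1)] by blast
    then have "y \<in> clin C" using y[OF sub] by simp
    then show ?thesis using \<open>countable C\<close> \<open>C \<subseteq> S\<close> unfolding U_def by blast
  qed
  have "clsub (cl U)"
  proof (rule closed_subspace_closure)
    show "U \<noteq> {}" using UI[of "{}" vzero] zero_in_closed_subspace by auto
    show "vadd p x y \<in> U" if "x \<in> U" "y \<in> U" for x y
      using that by (intro UI[of "{x, y}"]) (simp_all add: closed_subspace_def)
    show "vscale m r x \<in> U" if "x \<in> U" for r x
      using that by (intro UI[of "{x}"]) (simp_all add: closed_subspace_def)
  qed (rule UX)
  moreover have "cl U \<subseteq> U"
  proof
    fix y assume "y \<in> cl U"
    then obtain D where "countable D" "D \<subseteq> U" "y \<in> cl D"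
      using cl_countably_supported[OF UX] by blast
    moreover have "y \<in> F" if "clsub F" "D \<subseteq> F" for F
      using cl_subset_closed_subspace[OF that] \<open>y \<in> cl D\<close> by auto
    ultimately show "y \<in> U" by (intro UI[of D])
  qed
  then have "cl U = U" using closure_of_subset[of U T] UX by auto
  ultimately have "clsub U" by simp
  moreover have "S \<subseteq> U"
  proof
    fix y assume "y \<in> S"
    then have "countable {y}" "{y} \<subseteq> S" "y \<in> clin {y}"
      using clin_superset[of "{y}"] by auto
    then show "y \<in> U" unfolding U_def by blast
  qed
  ultimately have "x \<in> U" using assms(2) clin_minimal by blast
  then show thesis using that by (auto simp: U_def)
qed

lemma separable_subspace_iff:
  "sepsub F \<longleftrightarrow> clsub F \<and> (\<exists>D. countable D \<and> D \<subseteq> F \<and> F = cl D)"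
proof (cases "clsub F")
  case True
  have "topspace (subtopology T F) = F" using closed_subspace_subset[OF True] by auto
  moreover have "subtopology T F closure_of D = cl D" if "D \<subseteq> F" for D
    using that cl_subset_closed_subspace[OF True that]
    by (simp add: closure_of_subtopology Int_absorb1)
  ultimately show ?thesis
    using True unfolding separable_subspace_def separable_space_def by auto
qed (simp add: separable_subspace_def)

end


section \<open>Closing a set under finitary functions\<close>

definition closed_under :: "('a list \<Rightarrow> 'a) set \<Rightarrow> 'a set \<Rightarrow> bool" where
  "closed_under Fs M \<longleftrightarrow> (\<forall>f\<in>Fs. \<forall>xs\<in>lists M. f xs \<in> M)"

lemma closed_underD: "closed_under Fs M \<Longrightarrow> f \<in> Fs \<Longrightarrow> xs \<in> lists M \<Longrightarrow> f xs \<in> M"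
  by (simp add: closed_under_def)

lemma closed_under_mono: "closed_under Fs M \<Longrightarrow> Gs \<subseteq> Fs \<Longrightarrow> closed_under Gs M"
  by (auto simp: closed_under_def)

lemma closed_under_hull: "closed_under Fs (closed_under Fs hull S)"
proof (rule hull_in)
  fix \<M> assume "\<forall>M\<in>\<M>. closed_under Fs M"
  then show "closed_under Fs (\<Inter>\<M>)"
    unfolding closed_under_def lists_eq_set by blast
qed

lemma closed_under_Union_chain:
  assumes chain: "subset.chain UNIV \<M>" and "\<And>M. M \<in> \<M> \<Longrightarrow> closed_under Fs M" "\<M> \<noteq> {}"
  shows "closed_under Fs (\<Union>\<M>)"
  unfolding closed_under_def
proof (intro ballI)
  fix f xs assume f: "f \<in> Fs" and "xs \<in> lists (\<Union>\<M>)"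
  then have "set xs \<subseteq> \<Union>\<M>" by auto
  then obtain M where "M \<in> \<M>" "set xs \<subseteq> M"
    using finite_subset_Union_chain[OF _ _ assms(3) chain] by blast
  then show "f xs \<in> \<Union>\<M>" using assms(2) closed_underD f by (metis UnionI in_listsI subsetD)
qed

text \<open>A finite list over the union of a chain already lies in one member, so finitary closure
  is continuous along chains. This is what makes limits of hulls hulls again.\<close>

lemma hull_Union_chain:
  assumes "subset.chain UNIV ((hull) (closed_under Fs) ` \<C>)" "\<C> \<noteq> {}"
  shows "(\<Union>C\<in>\<C>. closed_under Fs hull C) = closed_under Fs hull (\<Union>\<C>)"
proof
  show "(\<Union>C\<in>\<C>. closed_under Fs hull C) \<subseteq> closed_under Fs hull (\<Union>\<C>)"
    by (intro UN_least hull_mono) auto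
  have "closed_under Fs (\<Union>C\<in>\<C>. closed_under Fs hull C)"
    using assms closed_under_hull by (intro closed_under_Union_chain) auto
  moreover have "\<Union>\<C> \<subseteq> (\<Union>C\<in>\<C>. closed_under Fs hull C)"
    by (auto intro: hull_inc)
  ultimately show "closed_under Fs hull (\<Union>\<C>) \<subseteq> (\<Union>C\<in>\<C>. closed_under Fs hull C)"
    by (intro hull_minimal)
qed

lemma countable_hull:
  assumes "countable Fs" "countable S"
  shows "countable (closed_under Fs hull S)"
proof -
  define step where "step M = M \<union> (\<Union>f\<in>Fs. f ` lists M)" for M
  define it where "it n = (step ^^ n) S" for n
  have it_Suc: "it (Suc n) = step (it n)" for n by (simp add: it_def)
  have "incseq it" by (rule incseq_SucI) (auto simp: it_Suc step_def)
  then have "it i \<subseteq> it j \<or> it j \<subseteq> it i" for i j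
    using linear[of i j] monoD by metis
  then have chain: "subset.chain UNIV (range it)" by (simp add: subset_chain_def)
  have "closed_under Fs (\<Union>n. it n)"
    unfolding closed_under_def
  proof (intro ballI)
    fix f xs assume f: "f \<in> Fs" and "xs \<in> lists (\<Union>n. it n)"
    then have "set xs \<subseteq> (\<Union>n. it n)" by auto
    then obtain n where "set xs \<subseteq> it n"
      using finite_subset_Union_chain[OF _ _ _ chain] by blast
    then have "f xs \<in> it (Suc n)" using f by (auto simp: it_Suc step_def)
    then show "f xs \<in> (\<Union>n. it n)" by blast
  qed
  moreover have "S \<subseteq> (\<Union>n. it n)"
    using UN_upper[of 0 UNIV it] by (simp add: it_def)
  ultimately have "closed_under Fs hull S \<subseteq> (\<Union>n. it n)" by (intro hull_minimal)
  moreover have "countable (it n)" for n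
  proof (induction n)
    case (Suc n)
    then show ?case unfolding it_Suc step_def using assms by auto
  qed (simp add: it_def assms)
  ultimately show ?thesis by (meson countable_UN countableI_type countable_subset)
qed


section \<open>Skolem functions\<close>

instance fm :: countable by countable_datatype

lemma sat_cong: "(\<And>i. i \<in> fv a \<Longrightarrow> e i = e' i) \<Longrightarrow> sat N e a \<longleftrightarrow> sat N e' a"
proof (induction a arbitrary: e e')
  case (FAll i a)
  have "sat N (e(i := x)) a \<longleftrightarrow> sat N (e'(i := x)) a" for x
    using FAll.prems by (intro FAll.IH) auto
  then show ?case by simp
next
  case (FEx i a)
  have "sat N (e(i := x)) a \<longleftrightarrow> sat N (e'(i := x)) a" for x
    using FEx.prems by (intro FEx.IH) auto
  then show ?case by simp
next
  case (FAnd a b)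
  show ?case using FAnd.IH[of e e'] FAnd.prems by simp
next
  case (FOr a b)
  show ?case using FOr.IH[of e e'] FOr.prems by simp
next
  case (FImp a b)
  show ?case using FImp.IH[of e e'] FImp.prems by simp
next
  case (FNeg a)
  show ?case using FNeg.IH[of e e'] FNeg.prems by simp
qed simp_all

lemma finite_fv: "finite (fv a)"
  by (induction a) auto

text \<open>The list \<open>es\<close> is the assignment, cut off beyond the free variables of \<open>a\<close>; this makes the
  Skolem functions finitary. Since truth in the whole universe is available for every formula, one
  family of Skolem functions serves all formulas at once.\<close>

definition skolem :: "nat \<times> fm \<Rightarrow> 'v::zfc_universe list \<Rightarrow> 'v" where
  "skolem = (\<lambda>(i, a) es. SOME x. sat UNIV ((\<lambda>j. es ! j)(i := x)) a)"

lemma skolem_witness: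
  assumes M: "closed_under (range skolem) M" and e: "range e \<subseteq> M" and x: "sat UNIV (e(i := x)) a"
  shows "\<exists>y\<in>M. sat UNIV (e(i := y)) a"
proof -
  define es where "es = map e [0..<Suc (Max (insert 0 (fv a)))]"
  have "j < Suc (Max (insert 0 (fv a)))" if "j \<in> fv a" for j
    using that finite_fv[of a] by (simp add: le_imp_less_Suc)
  then have sat_es: "sat UNIV ((\<lambda>j. es ! j)(i := y)) a \<longleftrightarrow> sat UNIV (e(i := y)) a" for y
    by (intro sat_cong) (auto simp: es_def simp del: upt_Suc)
  have "sat UNIV (e(i := skolem (i, a) es)) a"
    using x unfolding skolem_def sat_es[symmetric] by (auto intro: someI)
  moreover have "skolem (i, a) es \<in> M"
    using e by (intro closed_underD[OF M]) (auto simp: es_def image_subset_iff)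
  ultimately show ?thesis by blast
qed

text \<open>The Tarski-Vaught test: \<open>skolem_witness\<close> finds in \<open>M\<close> the witnesses of true existential
  formulas, and the counterexamples to false universal ones.\<close>

lemma skolem_closed_elementary:
  assumes M: "closed_under (range skolem) M" and "range e \<subseteq> M"
  shows "sat M e a \<longleftrightarrow> sat UNIV e a"
  using assms(2)
proof (induction a arbitrary: e)
  case (FAll i a)
  have IH: "sat M (e(i := x)) a \<longleftrightarrow> sat UNIV (e(i := x)) a" if "x \<in> M" for x
    using that FAll.prems by (intro FAll.IH) auto
  show ?case
    using IH skolem_witness[OF M FAll.prems, of i _ "FNeg a"] by auto
next
  case (FEx i a)
  have IH: "sat M (e(i := x)) a \<longleftrightarrow> sat UNIV (e(i := x)) a" if "x \<in> M" for x
    using that FEx.prems by (intro FEx.IH) auto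
  show ?case
    using IH skolem_witness[OF M FEx.prems, of i _ a] by auto
qed auto

lemma skolem_closed_absolute:
  assumes M: "closed_under (range skolem) M"
  shows "absolute_for a M"
  unfolding absolute_for_def
proof (intro allI impI)
  fix e :: "nat \<Rightarrow> 'a" assume e: "\<forall>i\<in>fv a. e i \<in> M"
  have "skolem undefined [] \<in> M"
    using closed_underD[OF M, of "skolem undefined" "[]"] by simp
  then obtain c where "c \<in> M" by blast
  define e' where "e' i = (if i \<in> fv a then e i else c)" for i
  have "sat N e a \<longleftrightarrow> sat N e' a" for N by (rule sat_cong) (simp add: e'_def)
  moreover have "range e' \<subseteq> M" using e \<open>c \<in> M\<close> by (auto simp: e'_def)
  ultimately show "sat M e a \<longleftrightarrow> sat UNIV e a" using skolem_closed_elementary[OF M] by blast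
qed


section \<open>Suitable models are closed under the functions they contain\<close>

lemma elts_vset_countable: "countable S \<Longrightarrow> elts (vset S) = S"
  by (rule elts_vset[OF countable_is_set])

lemma elts_eq_iff: "countable S \<Longrightarrow> elts z = S \<longleftrightarrow> z = vset S"
  by (metis elts_vset_countable vset_elts)

abbreviation FIff :: "fm \<Rightarrow> fm \<Rightarrow> fm" where
  "FIff a b \<equiv> FAnd (FImp a b) (FImp b a)"

definition doubleton_fm :: "nat \<Rightarrow> nat \<Rightarrow> nat \<Rightarrow> nat \<Rightarrow> fm" where
  "doubleton_fm u w s t = FAll u (FIff (FMem u w) (FOr (FEq u s) (FEq u t)))"

lemma sat_doubleton_fm:
  assumes "u \<noteq> w" "u \<noteq> s" "u \<noteq> t"
  shows "sat UNIV e (doubleton_fm u w s t) \<longleftrightarrow> e w = vset {e s, e t}"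
proof -
  have "sat UNIV e (doubleton_fm u w s t) \<longleftrightarrow> elts (e w) = {e s, e t}"
    using assms by (auto simp: doubleton_fm_def)
  also have "\<dots> \<longleftrightarrow> e w = vset {e s, e t}"
    by (simp add: elts_eq_iff)
  finally show ?thesis .
qed

text \<open>The formula \<open>\<langle>v\<^sub>1, v\<^sub>2\<rangle> \<in> v\<^sub>0\<close>, with the Kuratowski pair spelled out.\<close>

definition app_fm :: fm where
  "app_fm = FEx 3 (FAnd (FMem 3 0)
    (FAll 4 (FIff (FMem 4 3) (FOr (doubleton_fm 5 4 1 1) (doubleton_fm 5 4 1 2)))))"

lemma fv_app_fm: "fv app_fm = {0, 1, 2}"
  by (auto simp: app_fm_def doubleton_fm_def)

lemma sat_app_fm: "sat UNIV e app_fm \<longleftrightarrow> vpair (e 1) (e 2) \<in> elts (e 0)"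
proof -
  have "(\<forall>w. (w \<in> elts z \<longrightarrow> w = vset {x} \<or> w = vset {x, y}) \<and>
      (w = vset {x} \<or> w = vset {x, y} \<longrightarrow> w \<in> elts z)) \<longleftrightarrow> z = vpair x y" for x y z :: 'a
  proof -
    have "(\<forall>w. (w \<in> elts z \<longrightarrow> w = vset {x} \<or> w = vset {x, y}) \<and>
      (w = vset {x} \<or> w = vset {x, y} \<longrightarrow> w \<in> elts z)) \<longleftrightarrow> elts z = {vset {x}, vset {x, y}}"
      by blast
    also have "\<dots> \<longleftrightarrow> z = vpair x y"
      by (simp add: vpair_def elts_eq_iff)
    finally show ?thesis .
  qed
  then show ?thesis
    by (simp add: app_fm_def sat_doubleton_fm)
qed

definition vgraph :: "'v::zfc_universe set \<Rightarrow> ('v \<Rightarrow> 'v) \<Rightarrow> 'v" where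
  "vgraph S g = vset ((\<lambda>x. vpair x (g x)) ` S)"

lemma vpair_in_vgraph:
  assumes "S \<in> range elts"
  shows "vpair x y \<in> elts (vgraph S g) \<longleftrightarrow> x \<in> S \<and> y = g x"
proof -
  have "(\<lambda>x. vpair x (g x)) ` S \<in> range elts"
    using assms replacement[of "\<lambda>x. vpair x (g x)"] by auto
  then show ?thesis by (auto simp: vgraph_def elts_vset)
qed

text \<open>Absoluteness of \<open>\<exists>y. \<langle>x, y\<rangle> \<in> f\<close> puts a \<open>y\<close> into \<open>M\<close> that looks like a value of \<open>f\<close> at \<open>x\<close>
  from inside \<open>M\<close>; absoluteness of the matrix makes it the true value. Both are needed as \<open>M\<close> need not
  be transitive.\<close>

lemma model_closed_vgraph:
  assumes "absolute_for app_fm M" "absolute_for (FEx 2 app_fm) M"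
    and "S \<in> range elts" "vgraph S g \<in> M" "x \<in> S" "x \<in> M"
  shows "g x \<in> M"
proof -
  define e where "e = (\<lambda>_::nat. x)(0 := vgraph S g)"
  have "sat UNIV e (FEx 2 app_fm)"
    using assms by (simp add: sat_app_fm vpair_in_vgraph e_def)
  moreover have "\<forall>i\<in>fv (FEx 2 app_fm). e i \<in> M" using assms by (simp add: e_def)
  ultimately have "sat M e (FEx 2 app_fm)" using assms(2) unfolding absolute_for_def by blast
  then obtain y where y: "y \<in> M" "sat M (e(2 := y)) app_fm" by auto
  have "\<forall>i\<in>fv app_fm. (e(2 := y)) i \<in> M" using assms y by (simp add: e_def)
  then have "sat UNIV (e(2 := y)) app_fm" using assms(1) y unfolding absolute_for_def by blast
  then show ?thesis using y assms(3) by (simp add: sat_app_fm vpair_in_vgraph e_def)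
qed


section \<open>Spaces of models\<close>

context vbanach
begin

text \<open>Closure under these functions concerns lists of all lengths. On lists of unintended length the
  values are arbitrary; they only add further elements to a hull, which stays countable.\<close>

definition space_ops :: "('v list \<Rightarrow> 'v) set" where
  "space_ops = {\<lambda>_. vzero, \<lambda>xs. vadd p (xs ! 0) (xs ! 1)} \<union>
    range (\<lambda>q xs. vscale m (of_rat q) (hd xs))"

lemma countable_space_ops: "countable space_ops"
  by (simp add: space_ops_def)

lemma closed_subspace_model:
  assumes M: "closed_under space_ops M"
  shows "clsub (cl (elts X \<inter> M))"
proof (rule closed_subspace_closure_rational)
  show "elts X \<inter> M \<noteq> {}"
    using closed_underD[OF M, of "\<lambda>_. vzero" "[]"] closed by (auto simp: space_ops_def)
  show "vadd p x y \<in> elts X \<inter> M" if "x \<in> elts X \<inter> M" "y \<in> elts X \<inter> M" for x y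
    using closed_underD[OF M, of "\<lambda>xs. vadd p (xs ! 0) (xs ! 1)" "[x, y]"] that closed
    by (simp add: space_ops_def)
  show "vscale m (of_rat q) x \<in> elts X \<inter> M" if "x \<in> elts X \<inter> M" for q x
    using closed_underD[OF M, of "\<lambda>xs. vscale m (of_rat q) (hd xs)" "[x]"] that closed
    by (simp add: space_ops_def)
qed simp

lemma subset_cl_model: "S \<subseteq> elts X \<Longrightarrow> S \<subseteq> M \<Longrightarrow> S \<subseteq> cl (elts X \<inter> M)"
  using closure_of_subset[of "elts X \<inter> M" T] by auto

lemma separable_subspace_model:
  assumes "closed_under space_ops M" "countable M"
  shows "sepsub (cl (elts X \<inter> M))"
proof -
  have "elts X \<inter> M \<subseteq> cl (elts X \<inter> M)" by (rule subset_cl_model) auto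
  moreover have "countable (elts X \<inter> M)" using assms(2) by simp
  ultimately show ?thesis
    using closed_subspace_model[OF assms(1)] unfolding separable_subspace_iff by blast
qed

text \<open>The first rich family axiom speaks of separable subspaces only, so a countable set is first
  enlarged to one: the space of its hull under the operations of \<open>X\<close>.\<close>

lemma rich_family_absorbs:
  assumes "rich_family X p m nn \<F>" "countable D" "D \<subseteq> elts X"
  shows "\<exists>F\<in>\<F>. D \<subseteq> F"
proof -
  let ?M = "closed_under space_ops hull D"
  have "sepsub (cl (elts X \<inter> ?M))"
    using assms by (intro separable_subspace_model closed_under_hull countable_hull countable_space_ops)
  then obtain F where "F \<in> \<F>" "cl (elts X \<inter> ?M) \<subseteq> F"
    using assms(1) unfolding rich_family_def by blast
  moreover have "D \<subseteq> cl (elts X \<inter> ?M)"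
    using assms by (intro subset_cl_model hull_subset)
  ultimately show ?thesis by blast
qed


section \<open>From rich families to suitable models\<close>

text \<open>The limit axiom of rich families concerns increasing sequences, whereas models yield countable
  directed systems.\<close>

lemma countable_directed_incseq:
  assumes "countable \<G>" "\<G> \<noteq> {}"
    and directed: "\<And>F G. F \<in> \<G> \<Longrightarrow> G \<in> \<G> \<Longrightarrow> \<exists>H\<in>\<G>. F \<union> G \<subseteq> H"
  obtains F :: "nat \<Rightarrow> 'a set" where "incseq F" "range F \<subseteq> \<G>" "(\<Union>n. F n) = \<Union>\<G>"
proof -
  define E where "E = from_nat_into \<G>"
  have E: "\<G> = range E" using range_from_nat_into[OF assms(2,1)] by (simp add: E_def)
  define b where "b F G = (SOME H. H \<in> \<G> \<and> F \<union> G \<subseteq> H)" for F G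
  have b: "b F G \<in> \<G> \<and> F \<union> G \<subseteq> b F G" if "F \<in> \<G>" "G \<in> \<G>" for F G
    unfolding b_def by (rule someI_ex) (use directed[OF that] in blast)
  define F where "F = rec_nat (E 0) (\<lambda>n G. b G (E (Suc n)))"
  have F_Suc: "F (Suc n) = b (F n) (E (Suc n))" for n by (simp add: F_def)
  have F: "F n \<in> \<G>" for n
  proof (induction n)
    case (Suc n)
    then show ?case using b E F_Suc by auto
  qed (simp add: F_def E)
  have "F n \<subseteq> F (Suc n)" for n using b[OF F[of n], of "E (Suc n)"] E F_Suc by auto
  then have "incseq F" by (rule incseq_SucI)
  moreover have "E n \<subseteq> F n" for n
  proof (cases n)
    case (Suc k)
    then show ?thesis using b[OF F[of k], of "E n"] E F_Suc by auto
  qed (simp add: F_def)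
  then have "(\<Union>n. F n) = \<Union>\<G>" using F E by blast
  moreover have "range F \<subseteq> \<G>" using F by blast
  ultimately show thesis by (intro that)
qed

lemma range_elts_vset_image:
  assumes "\<And>F. F \<in> \<F> \<Longrightarrow> F \<subseteq> elts X"
  shows "vset ` \<F> \<in> range elts"
proof -
  obtain P where P: "elts P = {y. elts y \<subseteq> elts X}" using powerset[of X] by auto
  have "elts (vset F) = F" if "F \<in> \<F>" for F
    using assms[OF that] separation elts_vset by blast
  then have "vset ` \<F> \<subseteq> elts P" using assms by (auto simp: P)
  then show ?thesis by (rule separation)
qed

text \<open>The models are forced to know the family by placing graphs of choice functions into \<open>Y\<close>. In
  the proof \<open>g\<close> covers points of \<open>X\<close> by members of the family, \<open>h\<close> gives upper bounds of pairs
  of members, and \<open>d\<close> gives dense sequences; they yield respectively that the members of the family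
  in \<open>M\<close> cover \<open>X \<inter> M\<close>, are directed, and are contained in \<open>X\<^sub>M\<close>.\<close>

lemma rich_family_model_codes:
  assumes rich: "rich_family X p m nn \<F>"
  obtains Y where "countable Y"
    "\<And>M. suitable_model M [app_fm, FEx 2 app_fm] Y \<Longrightarrow> cl (elts X \<inter> M) \<in> \<F>"
proof -
  have sep: "sepsub F" if "F \<in> \<F>" for F using rich that by (simp add: rich_family_def)
  have "\<forall>F\<in>\<F>. \<exists>D. countable D \<and> D \<subseteq> F \<and> F = cl D"
    using sep by (simp add: separable_subspace_iff)
  then obtain D where D: "\<And>F. F \<in> \<F> \<Longrightarrow> countable (D F)" "\<And>F. F \<in> \<F> \<Longrightarrow> D F \<subseteq> F"
    "\<And>F. F \<in> \<F> \<Longrightarrow> F = cl (D F)"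
    using bchoice by metis
  have FX: "F \<subseteq> elts X" if "F \<in> \<F>" for F
    using sep[OF that] closed_subspace_subset by (simp add: separable_subspace_iff)
  have cl_F: "cl S \<subseteq> F" if "F \<in> \<F>" "S \<subseteq> F" for F S
    using sep[OF that(1)] that(2) cl_subset_closed_subspace by (simp add: separable_subspace_iff)
  have elts_F: "elts (vset F) = F" if "F \<in> \<F>" for F
    using FX[OF that] separation elts_vset by blast
  obtain pick where pick: "\<And>S. countable S \<Longrightarrow> S \<subseteq> elts X \<Longrightarrow> pick S \<in> \<F> \<and> S \<subseteq> pick S"
    using rich_family_absorbs[OF rich] by metis
  let ?\<Phi> = "vset ` \<F>"
  have \<Phi>: "?\<Phi> \<in> range elts" using FX by (rule range_elts_vset_image)
  define g where "g = vgraph (elts X) (\<lambda>x. vset (pick {x}))"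
  \<comment> \<open>The binary function is curried: the value of \<open>h\<close> at \<open>F\<close> is again a graph, so that models need
    not be closed under pairing.\<close>
  define h where "h F = vgraph ?\<Phi> (\<lambda>G. vset (pick (D (elts F) \<union> D (elts G))))" for F
  define d where "d n = vgraph ?\<Phi> (\<lambda>F. from_nat_into (D (elts F)) n)" for n
  \<comment> \<open>The zero vector makes \<open>X \<inter> M\<close> nonempty.\<close>
  define Y where "Y = {g, vgraph ?\<Phi> h, vzero} \<union> range d"
  have "cl (elts X \<inter> M) \<in> \<F>" if M: "suitable_model M [app_fm, FEx 2 app_fm] Y" for M
  proof -
    have "countable M" "Y \<subseteq> M" using M by (simp_all add: suitable_model_def)
    have app: "G x \<in> M" if "vgraph S G \<in> M" "S \<in> range elts" "x \<in> S" "x \<in> M" for G S x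
      using M that model_closed_vgraph[of M S G x] by (simp add: suitable_model_def)
    define \<G> where "\<G> = {F \<in> \<F>. vset F \<in> M}"
    have pick_\<G>: "pick {x} \<in> \<G>" if "x \<in> elts X \<inter> M" for x
      using app[of "elts X" "\<lambda>x. vset (pick {x})" x] that \<open>Y \<subseteq> M\<close> pick[of "{x}"]
      by (auto simp: \<G>_def Y_def g_def)
    have "inj_on vset \<G>" using elts_F by (intro inj_on_inverseI[of _ elts]) (simp add: \<G>_def)
    moreover have "vset ` \<G> \<subseteq> M" by (auto simp: \<G>_def)
    ultimately have "countable \<G>"
      using \<open>countable M\<close> countable_image_inj_on countable_subset by metis
    moreover have "vzero \<in> elts X \<inter> M" using \<open>Y \<subseteq> M\<close> closed by (auto simp: Y_def)
    then have "\<G> \<noteq> {}" using pick_\<G> by auto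
    moreover have "\<exists>H\<in>\<G>. F \<union> G \<subseteq> H" if "F \<in> \<G>" "G \<in> \<G>" for F G
    proof -
      have FG: "F \<in> \<F>" "G \<in> \<F>" "vset F \<in> M" "vset G \<in> M" using that by (auto simp: \<G>_def)
      let ?H = "pick (D F \<union> D G)"
      have H: "?H \<in> \<F>" "D F \<union> D G \<subseteq> ?H" using pick[of "D F \<union> D G"] D(1,2)[OF FG(1)] D(1,2)[OF FG(2)] FX[OF FG(1)] FX[OF FG(2)]
        by auto
      have "h (vset F) \<in> M" using app[of ?\<Phi> h "vset F"] \<Phi> FG \<open>Y \<subseteq> M\<close> by (auto simp: Y_def)
      then have "vset ?H \<in> M"
        using app[of ?\<Phi> "\<lambda>G. vset (pick (D F \<union> D (elts G)))" "vset G"] \<Phi> FG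
        by (simp add: h_def elts_F)
      moreover have "F \<union> G \<subseteq> ?H"
        using cl_F[OF H(1), of "D F"] cl_F[OF H(1), of "D G"] H(2) D(3)[OF FG(1)] D(3)[OF FG(2)]
        by auto
      ultimately show ?thesis using H by (auto simp: \<G>_def)
    qed
    ultimately obtain F :: "nat \<Rightarrow> 'v set" where F: "incseq F" "range F \<subseteq> \<G>" "(\<Union>n. F n) = \<Union>\<G>"
      by (rule countable_directed_incseq)
    have "cl (\<Union>\<G>) = cl (elts X \<inter> M)"
    proof
      have "G \<subseteq> cl (elts X \<inter> M)" if "G \<in> \<G>" for G
      proof -
        have G: "G \<in> \<F>" "vset G \<in> M" using that by (auto simp: \<G>_def)
        have "from_nat_into (D G) n \<in> M" for n
          using app[of ?\<Phi> "\<lambda>F. from_nat_into (D (elts F)) n" "vset G"] \<Phi> G \<open>Y \<subseteq> M\<close>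
          by (auto simp: Y_def d_def elts_F)
        then have "D G \<subseteq> M" using from_nat_into_surj[OF D(1)[OF G(1)]] by blast
        then have "cl (D G) \<subseteq> cl (elts X \<inter> M)"
          using D(2)[OF G(1)] FX[OF G(1)] by (intro closure_of_mono) blast
        then show ?thesis using D(3)[OF G(1)] by simp
      qed
      then have "cl (\<Union>\<G>) \<subseteq> cl (cl (elts X \<inter> M))" by (intro closure_of_mono) blast
      then show "cl (\<Union>\<G>) \<subseteq> cl (elts X \<inter> M)" by simp
      have "x \<in> \<Union>\<G>" if "x \<in> elts X \<inter> M" for x
        using pick_\<G>[OF that] pick[of "{x}"] that by auto
      then have "elts X \<inter> M \<subseteq> \<Union>\<G>" by blast
      then show "cl (elts X \<inter> M) \<subseteq> cl (\<Union>\<G>)" by (rule closure_of_mono)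
    qed
    moreover have "cl (\<Union>n. F n) \<in> \<F>"
      using rich F(1,2) unfolding rich_family_def \<G>_def by blast
    ultimately show ?thesis using F(3) by simp
  qed
  moreover have "countable Y" by (simp add: Y_def)
  ultimately show thesis using that by blast
qed

lemma rich_families_imp_suitable_models:
  assumes "sep_det_by_rich_families a X p m nn A f Cs"
  shows "sep_det_by_suitable_models a X p m nn A f Cs"
proof -
  obtain \<F> where \<F>: "rich_family X p m nn \<F>"
    "\<forall>F\<in>\<F>. statement_holds a X p m nn A f Cs \<longleftrightarrow> statement_holds_on a p m nn A f Cs F"
    using assms unfolding sep_det_by_rich_families_def by blast
  obtain Y where "countable Y"
    "\<And>M. suitable_model M [app_fm, FEx 2 app_fm] Y \<Longrightarrow> cl (elts X \<inter> M) \<in> \<F>"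
    using rich_family_model_codes[OF \<F>(1)] by blast
  then show ?thesis
    unfolding sep_det_by_suitable_models_def using \<F>(2) by blast
qed


section \<open>From suitable models to rich families\<close>

text \<open>An increasing sequence of spaces \<open>X\<^bsub>H(C)\<^esub>\<close> might come from unrelated sets \<open>C\<close>. Comparability
  turns the corresponding hulls into a chain (the order on it need not match the order of the
  sequence), and then the limit is the space of the hull of the union of the sets \<open>C\<close>.\<close>

lemma rich_family_of_hulls:
  fixes Fs J
  defines "H \<equiv> \<lambda>C. closed_under Fs hull C"
  assumes "countable Fs" "space_ops \<subseteq> Fs"
    and cofinal: "\<And>S. sepsub S \<Longrightarrow> \<exists>C\<subseteq>J. countable C \<and> S \<subseteq> cl (elts X \<inter> H C)"
    and comparable: "\<And>C C'. C \<subseteq> J \<Longrightarrow> C' \<subseteq> J \<Longrightarrow>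
      cl (elts X \<inter> H C) \<subseteq> cl (elts X \<inter> H C') \<Longrightarrow> H C \<subseteq> H C' \<or> H C' \<subseteq> H C"
  shows "rich_family X p m nn {cl (elts X \<inter> H C) |C. C \<subseteq> J \<and> countable C}"
  unfolding rich_family_def
proof (intro conjI ballI allI impI)
  fix F assume "F \<in> {cl (elts X \<inter> H C) |C. C \<subseteq> J \<and> countable C}"
  then obtain C where C: "countable C" "F = cl (elts X \<inter> H C)" by blast
  have "closed_under space_ops (H C)"
    using closed_under_mono[OF closed_under_hull assms(3)] by (simp add: H_def)
  moreover have "countable (H C)" using countable_hull assms(2) C by (auto simp: H_def)
  ultimately show "sepsub F" using separable_subspace_model C by simp
next
  fix S assume "sepsub S"
  then show "\<exists>F\<in>{cl (elts X \<inter> H C) |C. C \<subseteq> J \<and> countable C}. S \<subseteq> F" using cofinal by blast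
next
  fix F :: "nat \<Rightarrow> 'v set"
  assume inc: "incseq F" and "range F \<subseteq> {cl (elts X \<inter> H C) |C. C \<subseteq> J \<and> countable C}"
  then have "\<forall>n. \<exists>C. C \<subseteq> J \<and> countable C \<and> F n = cl (elts X \<inter> H C)" by blast
  then obtain C where C: "\<And>n. C n \<subseteq> J" "\<And>n. countable (C n)" "\<And>n. F n = cl (elts X \<inter> H (C n))"
    by metis
  have "H (C i) \<subseteq> H (C j) \<or> H (C j) \<subseteq> H (C i)" for i j
  proof -
    have "F i \<subseteq> F j \<or> F j \<subseteq> F i" using inc linear[of i j] monoD by metis
    then show ?thesis using comparable C by metis
  qed
  then have chain: "subset.chain UNIV (H ` range C)" by (simp add: subset_chain_def)
  have union: "(\<Union>n. H (C n)) = H (\<Union>n. C n)"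
    using hull_Union_chain[of Fs "range C"] chain by (simp add: H_def image_image)
  have "cl (\<Union>n. F n) = cl (elts X \<inter> H (\<Union>n. C n))"
  proof
    have "F n \<subseteq> cl (elts X \<inter> H (\<Union>n. C n))" for n
      unfolding C(3) union[symmetric] by (intro closure_of_mono) blast
    then have "cl (\<Union>n. F n) \<subseteq> cl (cl (elts X \<inter> H (\<Union>n. C n)))"
      by (intro closure_of_mono) blast
    then show "cl (\<Union>n. F n) \<subseteq> cl (elts X \<inter> H (\<Union>n. C n))" by simp
    have "elts X \<inter> H (C n) \<subseteq> F n" for n
      unfolding C(3) by (intro subset_cl_model) auto
    then show "cl (elts X \<inter> H (\<Union>n. C n)) \<subseteq> cl (\<Union>n. F n)"
      unfolding union[symmetric] by (intro closure_of_mono) blast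
  qed
  moreover have "(\<Union>n. C n) \<subseteq> J" "countable (\<Union>n. C n)" using C by auto
  ultimately show "cl (\<Union>n. F n) \<in> {cl (elts X \<inter> H C) |C. C \<subseteq> J \<and> countable C}" by blast
qed

text \<open>The extra functions \<open>Gs\<close> let the user of this lemma prescribe closure properties of the models
  beyond suitability; the hull is taken under \<open>Gs\<close>, the space operations, the Skolem functions and the
  required constants together. A hull of a subset of \<open>J\<close> is also the hull of its own trace on \<open>J\<close>, so it
  is enough to compare traces.\<close>

lemma suitable_models_imp_rich_families:
  fixes Gs J
  assumes models: "sep_det_by_suitable_models a X p m nn A f Cs"
    and "countable Gs"
    and cofinal: "\<And>S. sepsub S \<Longrightarrow> \<exists>C\<subseteq>J. countable C \<and>
      (\<forall>M. closed_under (Gs \<union> space_ops) M \<longrightarrow> C \<subseteq> M \<longrightarrow> S \<subseteq> cl (elts X \<inter> M))"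
    and comparable: "\<And>M M'. closed_under (Gs \<union> space_ops) M \<Longrightarrow>
      closed_under (Gs \<union> space_ops) M' \<Longrightarrow> cl (elts X \<inter> M) \<subseteq> cl (elts X \<inter> M') \<Longrightarrow>
      J \<inter> M \<subseteq> M' \<or> J \<inter> M' \<subseteq> M"
  shows "sep_det_by_rich_families a X p m nn A f Cs"
proof -
  obtain Y as where Y: "countable Y"
    and as: "\<And>M. suitable_model M as Y \<Longrightarrow> {X, p, m, nn, A, f} \<union> set Cs \<subseteq> M \<Longrightarrow>
        (statement_holds a X p m nn A f Cs \<longleftrightarrow>
         statement_holds_on a p m nn A f Cs (cl (elts X \<inter> M)))"
    using models unfolding sep_det_by_suitable_models_def by blast
  define K where "K = Y \<union> {X, p, m, nn, A, f} \<union> set Cs"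
  define Fs where "Fs = Gs \<union> space_ops \<union> range skolem \<union> (\<lambda>c _. c) ` K"
  define H where "H C = closed_under Fs hull C" for C
  have "countable K" using Y by (simp add: K_def countable_finite)
  then have Fs: "countable Fs" using assms(2) countable_space_ops by (simp add: Fs_def)
  have H: "closed_under Es (H C)" if "Es \<subseteq> Fs" for Es C
    using closed_under_mono[OF closed_under_hull that] by (simp add: H_def)
  have HG: "closed_under (Gs \<union> space_ops) (H C)" for C by (rule H) (auto simp: Fs_def)
  have C_H: "C \<subseteq> H C" for C unfolding H_def by (rule hull_subset)
  have H_min: "C \<subseteq> H C' \<Longrightarrow> H C \<subseteq> H C'" for C C'
    unfolding H_def by (intro hull_minimal closed_under_hull)
  have "rich_family X p m nn {cl (elts X \<inter> H C) |C. C \<subseteq> J \<and> countable C}"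
    unfolding H_def
  proof (rule rich_family_of_hulls[where Fs = Fs and J = J, OF Fs])
    show "space_ops \<subseteq> Fs" unfolding Fs_def by blast
  next
    fix S assume "sepsub S"
    from cofinal[OF this] obtain C where C: "C \<subseteq> J" "countable C"
      and S: "\<forall>M. closed_under (Gs \<union> space_ops) M \<longrightarrow> C \<subseteq> M \<longrightarrow> S \<subseteq> cl (elts X \<inter> M)"
      by (elim exE conjE)
    have "S \<subseteq> cl (elts X \<inter> H C)" using S HG C_H by simp
    with C show "\<exists>C\<subseteq>J. countable C \<and> S \<subseteq> cl (elts X \<inter> (closed_under Fs hull C))"
      unfolding H_def by blast
  next
    fix C C'
    assume C: "C \<subseteq> J" "C' \<subseteq> J"
      and "cl (elts X \<inter> (closed_under Fs hull C)) \<subseteq> cl (elts X \<inter> (closed_under Fs hull C'))"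
    then have "J \<inter> H C \<subseteq> H C' \<or> J \<inter> H C' \<subseteq> H C"
      using comparable[OF HG HG] by (simp add: H_def)
    then have "C \<subseteq> H C' \<or> C' \<subseteq> H C" using C C_H by blast
    then show "closed_under Fs hull C \<subseteq> closed_under Fs hull C' \<or>
        closed_under Fs hull C' \<subseteq> closed_under Fs hull C"
      using H_min unfolding H_def by blast
  qed
  moreover have "statement_holds a X p m nn A f Cs \<longleftrightarrow>
      statement_holds_on a p m nn A f Cs (cl (elts X \<inter> H C))" if "countable C" for C
  proof (rule as)
    have "c \<in> H C" if "c \<in> K" for c
    proof -
      have "closed_under {\<lambda>_. c} (H C)" using that by (intro H) (auto simp: Fs_def)
      from closed_underD[OF this, of "\<lambda>_. c" "[]"] show ?thesis by simp
    qed
    then have K: "K \<subseteq> H C" by blast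
    have "closed_under (range skolem) (H C)" by (rule H) (auto simp: Fs_def)
    moreover have "countable (H C)" unfolding H_def by (rule countable_hull[OF Fs that])
    ultimately show "suitable_model (H C) as Y"
      using K skolem_closed_absolute by (auto simp: suitable_model_def K_def)
    show "{X, p, m, nn, A, f} \<union> set Cs \<subseteq> H C" using K by (auto simp: K_def)
  qed
  ultimately show ?thesis unfolding sep_det_by_rich_families_def by blast
qed

text \<open>Closure under the enumerations of countable sets \<open>E z\<close> is how a countable model is made to
  contain the whole of \<open>E z\<close> with each of its elements \<open>z\<close>.\<close>

lemma enumeration_closed:
  assumes "closed_under (range (\<lambda>n xs. from_nat_into (E (hd xs)) n)) M" "z \<in> M" "countable (E z)"
  shows "E z \<subseteq> M"
proof
  fix i assume "i \<in> E z"
  then obtain n where "from_nat_into (E z) n = i" using from_nat_into_surj[OF assms(3)] by blast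
  then show "i \<in> M"
    using closed_underD[OF assms(1), of "\<lambda>xs. from_nat_into (E (hd xs)) n" "[z]"] assms(2) by auto
qed

text \<open>Each \<open>z\<close> has a countable support, and models contain the support of each of their vectors.
  Hence \<open>X\<^sub>M\<close> lies in the span of the \<open>x i\<close> with \<open>i \<in> I \<inter> M\<close>, and by minimality no other \<open>x i\<close>
  belongs to it: \<open>X\<^sub>M\<close> determines \<open>I \<inter> M\<close>.\<close>

lemma rich_families_of_fundamental_minimal_system:
  fixes I :: "'v set"
  assumes models: "sep_det_by_suitable_models a X p m nn A f Cs"
    and fms: "fundamental_minimal_system X p m nn I x"
  shows "sep_det_by_rich_families a X p m nn A f Cs"
proof -
  have xX: "x ` I \<subseteq> elts X" and span: "clin (x ` I) = elts X"
    and minimal: "\<And>i. i \<in> I \<Longrightarrow> x i \<notin> clin (x ` (I - {i}))"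
    using fms by (auto simp: fundamental_minimal_system_def)
  have "\<exists>E. countable E \<and> E \<subseteq> I \<and> z \<in> clin (x ` E)" if "z \<in> elts X" for z
  proof -
    have "z \<in> clin (x ` I)" using that span by simp
    then obtain C where "countable C" "C \<subseteq> x ` I" "z \<in> clin C"
      by (rule clin_countably_supported[OF xX])
    then obtain E where "countable E" "E \<subseteq> I" "C = x ` E"
      using countable_subset_image[of C x I] by auto
    then show ?thesis using \<open>z \<in> clin C\<close> by auto
  qed
  then have "\<forall>z\<in>elts X. \<exists>E. countable E \<and> E \<subseteq> I \<and> z \<in> clin (x ` E)" by blast
  from bchoice[OF this] obtain supp where supp:
    "\<And>z. z \<in> elts X \<Longrightarrow> countable (supp z)" "\<And>z. z \<in> elts X \<Longrightarrow> supp z \<subseteq> I"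
    "\<And>z. z \<in> elts X \<Longrightarrow> z \<in> clin (x ` supp z)"
    by auto
  define Gs where "Gs = {\<lambda>is. x (hd is)} \<union> range (\<lambda>n zs. from_nat_into (supp (hd zs)) n)"
  have x_M: "x i \<in> M" if "closed_under (Gs \<union> space_ops) M" "i \<in> M" for M i
    using closed_underD[OF that(1), of "\<lambda>is. x (hd is)" "[i]"] that(2) by (simp add: Gs_def)
  have model_subset: "cl (elts X \<inter> M) \<subseteq> clin (x ` (I \<inter> M))"
    if M: "closed_under (Gs \<union> space_ops) M" for M
  proof (rule cl_subset_closed_subspace)
    show "clsub (clin (x ` (I \<inter> M)))" using xX by (intro closed_subspace_clin) blast
    show "elts X \<inter> M \<subseteq> clin (x ` (I \<inter> M))"
    proof
      fix z assume z: "z \<in> elts X \<inter> M"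
      have "supp z \<subseteq> M"
        using closed_under_mono[OF M] z supp by (intro enumeration_closed) (auto simp: Gs_def)
      then have "clin (x ` supp z) \<subseteq> clin (x ` (I \<inter> M))"
        using supp(2) z by (intro clin_mono) blast
      then show "z \<in> clin (x ` (I \<inter> M))" using supp(3) z by blast
    qed
  qed
  show ?thesis
  proof (rule suitable_models_imp_rich_families[OF models, of Gs I])
    show "countable Gs" by (simp add: Gs_def)
  next
    fix S assume "sepsub S"
    then obtain D where D: "countable D" "D \<subseteq> S" "S = cl D" "S \<subseteq> elts X"
      using closed_subspace_subset by (auto simp: separable_subspace_iff)
    define C where "C = (\<Union>z\<in>D. supp z)"
    have DX: "z \<in> elts X" if "z \<in> D" for z using D that by blast
    have C: "C \<subseteq> I" "countable C"
      using supp(1,2)[OF DX] D(1) by (auto simp: C_def intro!: countable_UN)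
    moreover have "S \<subseteq> cl (elts X \<inter> M)" if M: "closed_under (Gs \<union> space_ops) M" "C \<subseteq> M" for M
    proof -
      have M': "clsub (cl (elts X \<inter> M))"
        using closed_under_mono[OF M(1)] by (intro closed_subspace_model) simp
      have "x ` C \<subseteq> cl (elts X \<inter> M)"
        using x_M[OF M(1)] M(2) C(1) xX by (intro subset_cl_model) blast+
      then have "clin (x ` C) \<subseteq> cl (elts X \<inter> M)" by (rule clin_minimal[OF _ M'])
      moreover have "z \<in> clin (x ` C)" if "z \<in> D" for z
      proof -
        have "clin (x ` supp z) \<subseteq> clin (x ` C)" using that by (intro clin_mono) (auto simp: C_def)
        then show ?thesis using supp(3)[OF DX] that by blast
      qed
      ultimately show ?thesis using cl_subset_closed_subspace[OF M'] D by blast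
    qed
    ultimately show "\<exists>C\<subseteq>I. countable C \<and>
        (\<forall>M. closed_under (Gs \<union> space_ops) M \<longrightarrow> C \<subseteq> M \<longrightarrow> S \<subseteq> cl (elts X \<inter> M))"
      by blast
  next
    fix M M'
    assume M: "closed_under (Gs \<union> space_ops) M" and M': "closed_under (Gs \<union> space_ops) M'"
      and sub: "cl (elts X \<inter> M) \<subseteq> cl (elts X \<inter> M')"
    have "i \<in> M'" if i: "i \<in> I" "i \<in> M" for i
    proof (rule ccontr)
      assume "i \<notin> M'"
      have "{x i} \<subseteq> cl (elts X \<inter> M)" using i x_M[OF M] xX by (intro subset_cl_model) auto
      then have "x i \<in> clin (x ` (I \<inter> M'))" using sub model_subset[OF M'] by blast
      moreover have "clin (x ` (I \<inter> M')) \<subseteq> clin (x ` (I - {i}))"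
        using \<open>i \<notin> M'\<close> by (intro clin_mono) blast
      ultimately show False using minimal[OF i(1)] by blast
    qed
    then show "I \<inter> M \<subseteq> M' \<or> I \<inter> M' \<subseteq> M" by blast
  qed
qed

text \<open>The cardinal \<open>|D|\<close> is a well-order of \<open>D\<close> with countable initial segments. Models contain the
  predecessors of each of their elements of \<open>D\<close>, so their traces on \<open>D\<close> are initial segments and form a
  chain; comparability holds whatever the spaces are.\<close>

lemma rich_families_of_density_aleph1:
  assumes models: "sep_det_by_suitable_models a X p m nn A f Cs"
    and dens: "has_density T aleph1"
  shows "sep_det_by_rich_families a X p m nn A f Cs"
proof -
  obtain D where D: "D \<subseteq> elts X" "cl D = elts X" "( |D|, aleph1) \<in> ordIso"
    using dens unfolding has_density_def topspace_T by blast
  let ?r = "|D|"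
  have wo: "well_order_on D ?r" "Field ?r = D"
    by (simp_all add: card_of_well_order_on Field_card_of)
  have pred: "countable (underS ?r d)" if "d \<in> D" for d
  proof -
    have "|underS ?r d| <o ?r" using that wo by (intro card_of_underS card_of_Card_order) simp
    then have "|underS ?r d| <o cardSuc natLeq"
      using D(3) unfolding aleph1_def by (rule ordLess_ordIso_trans)
    then have "|underS ?r d| \<le>o natLeq"
      using cardSuc_ordLeq_ordLess[OF natLeq_Card_order card_of_Card_order] by blast
    then show ?thesis by (simp add: countable_card_le_natLeq)
  qed
  define Gs where "Gs = range (\<lambda>n ds. from_nat_into (underS ?r (hd ds)) n)"
  show ?thesis
  proof (rule suitable_models_imp_rich_families[OF models, of Gs D])
    show "countable Gs" by (simp add: Gs_def)
  next
    fix S assume "sepsub S"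
    then obtain E where E: "countable E" "E \<subseteq> S" "S = cl E" "S \<subseteq> elts X"
      using closed_subspace_subset by (auto simp: separable_subspace_iff)
    have "\<forall>e\<in>E. \<exists>C. countable C \<and> C \<subseteq> D \<and> e \<in> cl C"
      using cl_countably_supported[OF D(1)] D(2) E by (metis subsetD)
    from bchoice[OF this] obtain c where c: "\<And>e. e \<in> E \<Longrightarrow> countable (c e)"
      "\<And>e. e \<in> E \<Longrightarrow> c e \<subseteq> D" "\<And>e. e \<in> E \<Longrightarrow> e \<in> cl (c e)" by auto
    define C where "C = (\<Union>e\<in>E. c e)"
    have C: "C \<subseteq> D" "countable C" using c(1,2) E(1) by (auto simp: C_def)
    moreover have "S \<subseteq> cl (elts X \<inter> M)" if "C \<subseteq> M" for M
    proof -
      have "cl (c e) \<subseteq> cl (elts X \<inter> M)" if "e \<in> E" for e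
        using that \<open>C \<subseteq> M\<close> C(1) D(1) by (intro closure_of_mono) (auto simp: C_def)
      then have "E \<subseteq> cl (elts X \<inter> M)" using c(3) by blast
      then have "cl E \<subseteq> cl (cl (elts X \<inter> M))" by (rule closure_of_mono)
      then show ?thesis using E by simp
    qed
    ultimately show "\<exists>C\<subseteq>D. countable C \<and>
        (\<forall>M. closed_under (Gs \<union> space_ops) M \<longrightarrow> C \<subseteq> M \<longrightarrow> S \<subseteq> cl (elts X \<inter> M))"
      by blast
  next
    fix M M'
    assume M: "closed_under (Gs \<union> space_ops) M" and M': "closed_under (Gs \<union> space_ops) M'"
    have initial: "underS ?r d \<subseteq> N"
      if "closed_under (Gs \<union> space_ops) N" "d \<in> D \<inter> N" for N d
      using closed_under_mono[OF that(1)] that(2) pred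
      by (intro enumeration_closed) (auto simp: Gs_def)
    have total: "d = d' \<or> d \<in> underS ?r d' \<or> d' \<in> underS ?r d" if "d \<in> D" "d' \<in> D" for d d'
      using that wo unfolding well_order_on_def linear_order_on_def total_on_def underS_def by auto
    show "D \<inter> M \<subseteq> M' \<or> D \<inter> M' \<subseteq> M"
      using total initial[OF M] initial[OF M'] by blast
  qed
qed

end

theorem theorem8:
  fixes X p m nn A f :: "'v::zfc_universe" and Cs :: "'v list" and a :: fm
  assumes "banach_space X p m nn"
    and "elts A \<subseteq> elts X"
    and "vfunction f" and "vdom f \<subseteq> elts X"
    and "fv a \<subseteq> {..<6 + length Cs}"
  shows "(sep_det_by_rich_families a X p m nn A f Cs \<longrightarrow>
          sep_det_by_suitable_models a X p m nn A f Cs) \<and>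
         ((\<exists>(I :: 'v) (x :: 'v \<Rightarrow> 'v). fundamental_minimal_system X p m nn (elts I) x) \<or>
          has_density (norm_topology X p m nn) aleph1 \<longrightarrow>
          (sep_det_by_suitable_models a X p m nn A f Cs \<longleftrightarrow>
           sep_det_by_rich_families a X p m nn A f Cs))"
proof -
  interpret vbanach X p m nn by unfold_locales (rule assms(1))
  show ?thesis
    using rich_families_imp_suitable_models rich_families_of_fundamental_minimal_system
      rich_families_of_density_aleph1
    by blast
qed

end
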